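(* Let $\Gamma$ be the complete graph with $d+1$ vertices ($d\ge1$), let $0\le\alpha<2$, and let $\rho:(0,\infty)\to[0,\infty)$ be nonincreasing with $\rho(s)\ge s^{-\alpha}$ for all $s>0$. Let $u:\Gamma\times J\to\mathbf{R}$, where $J\subset\mathbf{R}$ is an interval, be a solution, differentiable in $t$, of $$\partial_t u(v,t)=\frac1d\sum_{\tilde v\ne v}[u(\tilde v,t)-u(v,t)]\,\rho(|u(\tilde v,t)-u(v,t)|).$$ Then at every time $t\in J$ at which $u(\cdot,t)$ is not constant on $\Gamma$: $$\frac{d}{dt}\left(\mathrm{Var}_{u(\cdot,t)}^{\frac\alpha2}\right)\le-\begin{cases}\dfrac{\alpha\,(d+1)^{\frac{4-3\alpha}{2}}}{2\,d^{2-\alpha}}&\text{if }0<\alpha\le1,\\[2mm]\dfrac{\alpha\,(d+1)^{\frac{4-3\alpha}{2}}}{2\,d}&\text{if }1<\alpha<2,\end{cases}$$ and, in the case $\alpha=0$, $$\frac{d}{dt}\log\mathrm{Var}_{u(\cdot,t)}\le-\frac{(d+1)^2}{d^2}.$$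
   Context: For $w:\Gamma\to\mathbf{R}$, $\mathcal{A}_w=\frac1{d+1}\sum_{v}w(v)$ and $\mathrm{Var}_w=\frac{1}{d+1}\sum_v|w(v)-\mathcal{A}_w|^2$. Time is continuous. Terms $[u(\tilde v,t)-u(v,t)]\,\rho(|u(\tilde v,t)-u(v,t)|)$ with $u(\tilde v,t)=u(v,t)$ are interpreted as $0$. *)

theory Defs
  imports "HOL-Analysis.Analysis" "Graph_Theory.Kuratowski"
begin

definition graph_mean :: "('v, 'e) pre_digraph \<Rightarrow> ('v \<Rightarrow> real) \<Rightarrow> real" where
  "graph_mean \<Gamma> w = (1 / real (card (verts \<Gamma>))) * (\<Sum>v\<in>verts \<Gamma>. w v)"

definition graph_var :: "('v, 'e) pre_digraph \<Rightarrow> ('v \<Rightarrow> real) \<Rightarrow> real" where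
  "graph_var \<Gamma> w = (1 / real (card (verts \<Gamma>))) * (\<Sum>v\<in>verts \<Gamma>. \<bar>w v - graph_mean \<Gamma> w\<bar>\<^sup>2)"

(* The function \<rho> is meaningful only on the positive reals; a summand with u w t = u v t
   is 0 whatever the value of \<rho> at 0.  The derivative is one-sided at an endpoint of J that
   belongs to J. *)
definition diffusion_solution ::
  "('v, 'e) pre_digraph \<Rightarrow> nat \<Rightarrow> (real \<Rightarrow> real) \<Rightarrow> real set \<Rightarrow> ('v \<Rightarrow> real \<Rightarrow> real) \<Rightarrow> bool" where
  "diffusion_solution \<Gamma> d \<rho> J u \<longleftrightarrow>
     (\<forall>v\<in>verts \<Gamma>. \<forall>t\<in>J.
        (u v has_real_derivative
           (1 / real d) * (\<Sum>w\<in>verts \<Gamma> - {v}. (u w t - u v t) * \<rho> \<bar>u w t - u v t\<bar>))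
        (at t within J))"

end

theory Submission
  imports Defs
begin

text \<open>
  Write \<open>n = d + 1\<close>, \<open>p = 2 - \<alpha>\<close> and \<open>V\<close> for the variance. Symmetrizing the double sum gives
  \<open>V' = - E / (n d)\<close> with \<open>E = \<Sum> (u w - u v)\<^sup>2 \<rho> \<bar>u w - u v\<bar> \<ge> \<Sum> \<bar>u w - u v\<bar>\<^sup>p\<close>, the sums being over
  ordered pairs. For fixed \<open>v\<close> the differences \<open>u w - u v\<close> add up to \<open>n\<close> times the deviation of
  \<open>u v\<close> from the mean, so subadditivity of \<open>x\<^sup>p\<close> (\<open>p \<le> 1\<close>) or the power mean inequality (\<open>p \<ge> 1\<close>)
  bounds \<open>C \<Sum> \<bar>u w - u v\<bar>\<^sup>p\<close> from below by \<open>n\<^sup>p\<close> times the sum of the \<open>p\<close>-th powers of the absolute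
  deviations, where \<open>C = max 1 d\<^bsup>p - 1\<^esup>\<close>. As \<open>p \<le> 2\<close>, that sum is at least \<open>(n V)\<^bsup>p / 2\<^esup>\<close>. The
  exponents of \<open>V\<close> cancel in the derivative of \<open>V\<^bsup>\<alpha> / 2\<^esup>\<close>, and of \<open>ln V\<close> when \<open>\<alpha> = 0\<close>.
\<close>

section \<open>Inequalities between powers of sums and sums of powers\<close>

lemma powr_sum_le_sum_powr:
  fixes x :: "'a \<Rightarrow> real"
  assumes "finite A" and nonneg: "\<And>i. i \<in> A \<Longrightarrow> 0 \<le> x i" and p: "p \<le> 1"
  shows "(\<Sum>i\<in>A. x i) powr p \<le> (\<Sum>i\<in>A. x i powr p)"
proof (cases "(\<Sum>i\<in>A. x i) = 0")
  case True
  \<comment> \<open>The left side is \<open>0 powr p\<close>, which is 0 for every \<open>p\<close>,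
    including \<open>p = 0\<close>.\<close>
  then show ?thesis by (simp add: sum_nonneg)
next
  case False
  define S where "S = (\<Sum>i\<in>A. x i)"
  have S: "S > 0" using False nonneg by (simp add: S_def order_le_neq_trans sum_nonneg)
  \<comment> \<open>After normalization by \<open>S\<close> all terms lie in [0,1], where passing
    from exponent 1 to the smaller exponent \<open>p\<close> cannot decrease a power.\<close>
  have "1 = (\<Sum>i\<in>A. x i / S)" using S by (simp add: S_def flip: sum_divide_distrib)
  also have "\<dots> \<le> (\<Sum>i\<in>A. (x i / S) powr p)"
  proof (rule sum_mono)
    fix i assume i: "i \<in> A"
    have "x i \<le> S" unfolding S_def using assms i by (intro member_le_sum) auto
    then show "x i / S \<le> (x i / S) powr p"
      using powr_mono'[OF p, of "x i / S"] nonneg[OF i] S by simp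
  qed
  also have "\<dots> = (\<Sum>i\<in>A. x i powr p) / S powr p"
    by (simp add: powr_divide nonneg sum_divide_distrib)
  finally show ?thesis using S by (simp add: field_simps flip: S_def)
qed

text \<open>The graph of the convex function \<open>y powr p\<close> lies above its tangent at
  \<open>y = 1\<close>. The inequality comes from Young's inequality for \<open>y powr p\<close> and
  1 with weights \<open>1 / p\<close> and \<open>1 - 1 / p\<close>.\<close>

lemma Bernoulli_inequality_powr:
  fixes y p :: real
  assumes "0 \<le> y" "1 \<le> p"
  shows "1 + p * (y - 1) \<le> y powr p"
proof (cases "y = 0")
  case False
  have "y = (y powr p) powr (1 / p) * 1 powr (1 - 1 / p)"
    using assms False by (simp add: powr_powr)
  also have "\<dots> \<le> (1 / p) * y powr p + (1 - 1 / p) * 1"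
    using assms False by (intro Youngs_inequality_0) auto
  finally have "p * y \<le> p * ((1 / p) * y powr p + (1 - 1 / p) * 1)"
    using assms by (intro mult_left_mono) auto
  also have "\<dots> = y powr p + p - 1" using assms by (simp add: field_simps)
  finally show ?thesis by (simp add: algebra_simps)
qed (use assms in simp)

text \<open>Power mean inequality: Bernoulli is applied to each \<open>x i\<close> divided by the
  arithmetic mean \<open>S / k\<close>.\<close>

lemma powr_sum_le_card_powr_mult_sum_powr:
  fixes x :: "'a \<Rightarrow> real"
  assumes "finite A" and nonneg: "\<And>i. i \<in> A \<Longrightarrow> 0 \<le> x i" and p: "1 \<le> p"
  shows "(\<Sum>i\<in>A. x i) powr p \<le> real (card A) powr (p - 1) * (\<Sum>i\<in>A. x i powr p)"
proof (cases "(\<Sum>i\<in>A. x i) = 0")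
  case True
  then show ?thesis by (simp add: sum_nonneg)
next
  case False
  define S where "S = (\<Sum>i\<in>A. x i)"
  define k where "k = real (card A)"
  have S: "S > 0" using False nonneg by (simp add: S_def order_le_neq_trans sum_nonneg)
  have "A \<noteq> {}" using False by auto
  then have k: "k > 0" using assms(1) by (simp add: k_def card_gt_0_iff)
  \<comment> \<open>The rescaled values have mean 1, so the linear terms of the Bernoulli bounds
    cancel on summation and only \<open>k\<close> remains.\<close>
  have "(\<Sum>i\<in>A. k / S * x i) = k"
    using S unfolding sum_distrib_left[symmetric] S_def[symmetric] by simp
  then have "k = (\<Sum>i\<in>A. 1 + p * (k / S * x i - 1))"
    by (simp add: sum.distrib sum_subtractf k_def flip: sum_distrib_left)
  also have "\<dots> \<le> (\<Sum>i\<in>A. (k / S * x i) powr p)"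
    using S k nonneg p by (intro sum_mono Bernoulli_inequality_powr) auto
  also have "\<dots> = k powr p / S powr p * (\<Sum>i\<in>A. x i powr p)"
    using S k by (simp add: powr_mult powr_divide nonneg sum_distrib_left)
  finally have "k * S powr p \<le> k powr p * (\<Sum>i\<in>A. x i powr p)"
    using S by (simp add: field_simps)
  then show ?thesis using k by (simp add: powr_diff field_simps flip: S_def k_def)
qed

text \<open>The maximum dominates the constant of either regime: 1 from subadditivity when
  \<open>p \<le> 1\<close>, the power of the cardinality otherwise. Both ranges of \<alpha> can thus
  be treated together until the end.\<close>

lemma abs_sum_powr_le:
  fixes x :: "'a \<Rightarrow> real"
  assumes "finite A" "0 \<le> p"
  shows "\<bar>\<Sum>i\<in>A. x i\<bar> powr p
    \<le> max 1 (real (card A) powr (p - 1)) * (\<Sum>i\<in>A. \<bar>x i\<bar> powr p)" (is "_ \<le> max 1 ?k * ?S")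
proof -
  have S: "0 \<le> ?S" by (simp add: sum_nonneg)
  have "\<bar>\<Sum>i\<in>A. x i\<bar> powr p \<le> (\<Sum>i\<in>A. \<bar>x i\<bar>) powr p"
    using assms by (intro powr_mono2) auto
  also have "\<dots> \<le> max 1 ?k * ?S"
  proof (cases "p \<le> 1")
    case True
    have "(\<Sum>i\<in>A. \<bar>x i\<bar>) powr p \<le> 1 * ?S"
      using powr_sum_le_sum_powr[OF assms(1) _ True, of "\<lambda>i. \<bar>x i\<bar>"] by simp
    also have "\<dots> \<le> max 1 ?k * ?S" using S by (intro mult_right_mono) auto
    finally show ?thesis .
  next
    case False
    have "(\<Sum>i\<in>A. \<bar>x i\<bar>) powr p \<le> ?k * ?S"
      using powr_sum_le_card_powr_mult_sum_powr[OF assms(1), of "\<lambda>i. \<bar>x i\<bar>" p] False by simp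
    also have "\<dots> \<le> max 1 ?k * ?S" using S by (intro mult_right_mono) auto
    finally show ?thesis .
  qed
  finally show ?thesis .
qed

section \<open>Double sums and the variance on the vertex set\<close>

lemma sum_sum_antisymmetric:
  fixes f :: "'a \<Rightarrow> real"
  assumes "\<And>v w. g w v = - g v w"
  shows "(\<Sum>v\<in>A. f v * (\<Sum>w\<in>A. g v w)) = - (1 / 2) * (\<Sum>v\<in>A. \<Sum>w\<in>A. (f w - f v) * g v w)"
proof -
  let ?L = "\<Sum>v\<in>A. \<Sum>w\<in>A. f v * g v w"
  \<comment> \<open>Discrete integration by parts: swapping the summation indices and using
    antisymmetry of \<open>g\<close> turns the \<open>f w\<close> half into minus the
    \<open>f v\<close> half.\<close>
  have "(\<Sum>v\<in>A. \<Sum>w\<in>A. f w * g v w) = (\<Sum>v\<in>A. \<Sum>w\<in>A. f v * g w v)"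
    by (rule sum.swap)
  also have "\<dots> = - ?L" by (subst assms) (simp add: sum_negf)
  finally have "(\<Sum>v\<in>A. \<Sum>w\<in>A. (f w - f v) * g v w) = - 2 * ?L"
    by (simp add: left_diff_distrib sum_subtractf)
  then show ?thesis by (simp add: sum_distrib_left)
qed

lemma sum_diff_graph_mean:
  assumes "finite (verts \<Gamma>)"
  shows "(\<Sum>v\<in>verts \<Gamma>. x v - graph_mean \<Gamma> x) = 0"
proof (cases "verts \<Gamma> = {}")
  case False
  then have "real (card (verts \<Gamma>)) * graph_mean \<Gamma> x = (\<Sum>v\<in>verts \<Gamma>. x v)"
    using assms by (simp add: graph_mean_def)
  then show ?thesis by (simp add: sum_subtractf)
qed simp

lemma graph_var_pos:
  assumes fin: "finite (verts \<Gamma>)" and nc: "\<not> x constant_on verts \<Gamma>"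
  shows "graph_var \<Gamma> x > 0"
proof -
  obtain v where v: "v \<in> verts \<Gamma>" "x v \<noteq> graph_mean \<Gamma> x"
    using nc unfolding constant_on_def by blast
  have "0 < (\<Sum>v\<in>verts \<Gamma>. \<bar>x v - graph_mean \<Gamma> x\<bar>\<^sup>2)"
    using v fin by (intro sum_pos2[of _ v]) auto
  moreover have "card (verts \<Gamma>) > 0" using v fin by (auto simp: card_gt_0_iff)
  ultimately show ?thesis by (simp add: graph_var_def)
qed

text \<open>A Poincare-type inequality on the complete graph. Of the exponent
  \<open>3 * p / 2\<close>, a share \<open>p\<close> comes from the factor \<open>n\<close> in
  \<open>dev\<close>, and \<open>p / 2\<close> from \<open>n * graph_var \<Gamma> x\<close> being
  the sum of squared deviations.\<close>

lemma graph_var_powr_le: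
  fixes \<Gamma> :: "('v, 'e) pre_digraph" and x :: "'v \<Rightarrow> real"
  assumes fin: "finite (verts \<Gamma>)" and card: "card (verts \<Gamma>) = d + 1"
    and p: "0 \<le> p" "p \<le> 2"
  shows "real (d + 1) powr (3 * p / 2) * graph_var \<Gamma> x powr (p / 2)
    \<le> max 1 (real d powr (p - 1)) * (\<Sum>v\<in>verts \<Gamma>. \<Sum>w\<in>verts \<Gamma>. \<bar>x w - x v\<bar> powr p)"
    (is "_ \<le> ?C * ?E")
proof -
  define n where "n = real (d + 1)"
  define m where "m = graph_mean \<Gamma> x"
  have n: "n > 0" by (simp add: n_def)
  \<comment> \<open>The vanishing term \<open>w = v\<close> is dropped so that only \<open>d\<close>
    summands remain; this gives \<open>d\<close> rather than \<open>d + 1\<close> in the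
    constant.\<close>
  have dev: "n * \<bar>x v - m\<bar> = \<bar>\<Sum>w\<in>verts \<Gamma> - {v}. x w - x v\<bar>" if v: "v \<in> verts \<Gamma>" for v
  proof -
    have "(\<Sum>w\<in>verts \<Gamma> - {v}. x w - x v) = (\<Sum>w\<in>verts \<Gamma>. x w - x v)"
      using fin v by (simp add: sum.remove[of _ v])
    also have "\<dots> = n * (m - x v)"
      by (simp add: sum_subtractf card m_def graph_mean_def n_def field_simps)
    finally show ?thesis using n by (simp add: abs_mult abs_minus_commute)
  qed
  have "n powr (3 * p / 2) * graph_var \<Gamma> x powr (p / 2)
      = n powr p * (n * graph_var \<Gamma> x) powr (p / 2)"
    using n by (simp add: powr_mult flip: powr_add)
  also have "n * graph_var \<Gamma> x = (\<Sum>v\<in>verts \<Gamma>. \<bar>x v - m\<bar>\<^sup>2)"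
    by (simp add: graph_var_def card n_def m_def)
  \<comment> \<open>Here \<open>p \<le> 2\<close> enters: the exponent \<open>p / 2\<close> is at
    most 1, so subadditivity applies to the squares.\<close>
  also have "n powr p * \<dots> powr (p / 2) \<le> n powr p * (\<Sum>v\<in>verts \<Gamma>. (\<bar>x v - m\<bar>\<^sup>2) powr (p / 2))"
    using p fin by (intro mult_left_mono powr_sum_le_sum_powr) auto
  also have "\<dots> = (\<Sum>v\<in>verts \<Gamma>. (n * \<bar>x v - m\<bar>) powr p)"
  proof -
    have "(\<bar>y\<bar>\<^sup>2) powr (p / 2) = \<bar>y\<bar> powr p" for y :: real
      using powr_powr[of "\<bar>y\<bar>" 2 "p / 2"] by simp
    then show ?thesis by (simp only: sum_distrib_left powr_mult)
  qed
  also have "\<dots> \<le> (\<Sum>v\<in>verts \<Gamma>. ?C * (\<Sum>w\<in>verts \<Gamma> - {v}. \<bar>x w - x v\<bar> powr p))"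
  proof (rule sum_mono)
    fix v assume v: "v \<in> verts \<Gamma>"
    show "(n * \<bar>x v - m\<bar>) powr p \<le> ?C * (\<Sum>w\<in>verts \<Gamma> - {v}. \<bar>x w - x v\<bar> powr p)"
      using abs_sum_powr_le[of "verts \<Gamma> - {v}" p "\<lambda>w. x w - x v"] fin p v card
      by (simp add: dev)
  qed
  \<comment> \<open>The diagonal terms return at no cost, since \<open>0 powr p = 0\<close> even for
    \<open>p = 0\<close>.\<close>
  also have "\<dots> = ?C * ?E"
    using fin by (simp add: sum_distrib_left sum.remove)
  finally show ?thesis by (simp add: n_def)
qed

section \<open>Evolution of the variance\<close>

lemma graph_var_has_derivative:
  assumes fin: "finite (verts \<Gamma>)"
    and u': "\<And>v. v \<in> verts \<Gamma> \<Longrightarrow> (u v has_real_derivative u' v) (at t within J)"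
  shows "((\<lambda>s. graph_var \<Gamma> (\<lambda>v. u v s)) has_real_derivative
    2 / real (card (verts \<Gamma>)) * (\<Sum>v\<in>verts \<Gamma>. (u v t - graph_mean \<Gamma> (\<lambda>v. u v t)) * u' v))
    (at t within J)"
proof -
  let ?m = "graph_mean \<Gamma> (\<lambda>v. u v t)"
  define m' where "m' = 1 / real (card (verts \<Gamma>)) * (\<Sum>v\<in>verts \<Gamma>. u' v)"
  have m': "((\<lambda>s. graph_mean \<Gamma> (\<lambda>v. u v s)) has_real_derivative m') (at t within J)"
    unfolding graph_mean_def m'_def by (intro DERIV_cmult DERIV_sum u')
  have "((\<lambda>s. \<Sum>v\<in>verts \<Gamma>. (u v s - graph_mean \<Gamma> (\<lambda>v. u v s))\<^sup>2) has_real_derivative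
      (\<Sum>v\<in>verts \<Gamma>. 2 * ((u v t - ?m) * (u' v - m')))) (at t within J)"
    by (intro DERIV_sum) (auto intro!: derivative_eq_intros u' m')
  \<comment> \<open>The derivative \<open>m'\<close> of the mean is multiplied by the sum of the
    deviations, which is zero, and so drops out.\<close>
  moreover have "(\<Sum>v\<in>verts \<Gamma>. 2 * ((u v t - ?m) * (u' v - m')))
      = 2 * (\<Sum>v\<in>verts \<Gamma>. (u v t - ?m) * u' v) - 2 * m' * (\<Sum>v\<in>verts \<Gamma>. u v t - ?m)"
    by (simp add: sum_distrib_left sum_subtractf[symmetric] algebra_simps)
  ultimately have "((\<lambda>s. \<Sum>v\<in>verts \<Gamma>. (u v s - graph_mean \<Gamma> (\<lambda>v. u v s))\<^sup>2) has_real_derivative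
      2 * (\<Sum>v\<in>verts \<Gamma>. (u v t - ?m) * u' v)) (at t within J)"
    using sum_diff_graph_mean[OF fin] by simp
  from DERIV_cmult[OF this, of "1 / real (card (verts \<Gamma>))"]
  show ?thesis by (simp add: graph_var_def)
qed

lemma diffusion_graph_var_has_derivative:
  fixes \<Gamma> :: "('v, 'e) pre_digraph"
  assumes fin: "finite (verts \<Gamma>)" and sol: "diffusion_solution \<Gamma> d \<rho> J u" and t: "t \<in> J"
  shows "((\<lambda>s. graph_var \<Gamma> (\<lambda>v. u v s)) has_real_derivative
    - (1 / (real (card (verts \<Gamma>)) * real d)) *
      (\<Sum>v\<in>verts \<Gamma>. \<Sum>w\<in>verts \<Gamma>. (u w t - u v t)\<^sup>2 * \<rho> \<bar>u w t - u v t\<bar>)) (at t within J)"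
proof -
  define g where "g v w = (u w t - u v t) * \<rho> \<bar>u w t - u v t\<bar>" for v w
  let ?m = "graph_mean \<Gamma> (\<lambda>v. u v t)"
  have "(u v has_real_derivative (1 / real d) * (\<Sum>w\<in>verts \<Gamma>. g v w)) (at t within J)"
    if v: "v \<in> verts \<Gamma>" for v
  proof -
    \<comment> \<open>The term \<open>w = v\<close> has the factor 0, whatever the value of \<rho>
      at 0.\<close>
    have "(\<Sum>w\<in>verts \<Gamma> - {v}. g v w) = (\<Sum>w\<in>verts \<Gamma>. g v w)"
      using fin v by (simp add: sum.remove[of _ v] g_def)
    then show ?thesis
      using bspec[OF bspec[OF sol[unfolded diffusion_solution_def] v] t] by (simp add: g_def)
  qed
  note D = graph_var_has_derivative[of \<Gamma> u, OF fin this]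
  have "(\<Sum>v\<in>verts \<Gamma>. (u v t - ?m) * (1 / real d * (\<Sum>w\<in>verts \<Gamma>. g v w)))
      = 1 / real d * (\<Sum>v\<in>verts \<Gamma>. (u v t - ?m) * (\<Sum>w\<in>verts \<Gamma>. g v w))"
    unfolding sum_distrib_left by (intro sum.cong) (simp_all add: mult_ac)
  \<comment> \<open>\<open>g\<close> is antisymmetric because \<rho> sees only the absolute
    difference, and the mean cancels in the difference of two deviations. The 2 in the denominator
    later cancels the 2 from differentiating the square.\<close>
  also have "\<dots> = - (1 / (2 * real d)) *
      (\<Sum>v\<in>verts \<Gamma>. \<Sum>w\<in>verts \<Gamma>. (u w t - u v t)\<^sup>2 * \<rho> \<bar>u w t - u v t\<bar>)"
    by (subst sum_sum_antisymmetric)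
       (auto simp: g_def abs_minus_commute power2_eq_square algebra_simps)
  finally show ?thesis using D by simp
qed

text \<open>A closed differential inequality for the variance, valid for all \<alpha> in question;
  the case distinctions of the theorem only evaluate its constant.\<close>

lemma graph_var_dissipation:
  fixes \<Gamma> :: "('v, 'e) pre_digraph"
  assumes fin: "finite (verts \<Gamma>)" and card: "card (verts \<Gamma>) = d + 1" and d: "d \<ge> 1"
    and \<alpha>: "0 \<le> \<alpha>" "\<alpha> \<le> 2"
    and \<rho>: "\<And>s. s > 0 \<Longrightarrow> s powr (- \<alpha>) \<le> \<rho> s"
    and sol: "diffusion_solution \<Gamma> d \<rho> J u" and t: "t \<in> J"
  obtains V' where
    "((\<lambda>s. graph_var \<Gamma> (\<lambda>v. u v s)) has_real_derivative V') (at t within J)"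
    "V' \<le> - (real (d + 1) powr ((4 - 3 * \<alpha>) / 2) / (real d * max 1 (real d powr (1 - \<alpha>)))
              * graph_var \<Gamma> (\<lambda>v. u v t) powr (1 - \<alpha> / 2))"
proof -
  define E where "E = (\<Sum>v\<in>verts \<Gamma>. \<Sum>w\<in>verts \<Gamma>. (u w t - u v t)\<^sup>2 * \<rho> \<bar>u w t - u v t\<bar>)"
  define n where "n = real (d + 1)"
  define C where "C = max 1 (real d powr (1 - \<alpha>))"
  define V where "V = graph_var \<Gamma> (\<lambda>v. u v t)"
  have n: "n > 0" and C: "C > 0" by (auto simp: n_def C_def)
  have "\<bar>\<delta>\<bar> powr (2 - \<alpha>) \<le> \<delta>\<^sup>2 * \<rho> \<bar>\<delta>\<bar>" for \<delta> :: real
  proof (cases "\<delta> = 0")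
    case False
    have "\<bar>\<delta>\<bar> powr (2 - \<alpha>) = \<delta>\<^sup>2 * \<bar>\<delta>\<bar> powr (- \<alpha>)"
      using False by (simp add: powr_diff powr_minus field_simps)
    then show ?thesis using \<rho>[of "\<bar>\<delta>\<bar>"] False by (simp add: mult_left_mono)
  qed simp
  then have "(\<Sum>v\<in>verts \<Gamma>. \<Sum>w\<in>verts \<Gamma>. \<bar>u w t - u v t\<bar> powr (2 - \<alpha>)) \<le> E"
    unfolding E_def by (intro sum_mono)
  then have "C * (\<Sum>v\<in>verts \<Gamma>. \<Sum>w\<in>verts \<Gamma>. \<bar>u w t - u v t\<bar> powr (2 - \<alpha>)) \<le> C * E"
    using C by (intro mult_left_mono) auto
  moreover have "n powr (3 * (2 - \<alpha>) / 2) * V powr ((2 - \<alpha>) / 2)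
      \<le> C * (\<Sum>v\<in>verts \<Gamma>. \<Sum>w\<in>verts \<Gamma>. \<bar>u w t - u v t\<bar> powr (2 - \<alpha>))"
    using graph_var_powr_le[OF fin card, of "2 - \<alpha>" "\<lambda>v. u v t"] \<alpha>
    by (simp add: n_def C_def V_def)
  ultimately have "n powr (3 * (2 - \<alpha>) / 2) * V powr ((2 - \<alpha>) / 2) \<le> C * E"
    by simp
  \<comment> \<open>One factor \<open>n\<close> is split off to cancel the \<open>n\<close> in the
    prefactor \<open>1 / (n * real d)\<close> of the derivative.\<close>
  moreover have "n powr (3 * (2 - \<alpha>) / 2) = n * n powr ((4 - 3 * \<alpha>) / 2)"
    using n by (simp add: powr_mult_base field_simps)
  moreover have "(2 - \<alpha>) / 2 = 1 - \<alpha> / 2" by (simp add: field_simps)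
  ultimately have "n * (n powr ((4 - 3 * \<alpha>) / 2) * V powr (1 - \<alpha> / 2)) / (n * real d * C)
      \<le> C * E / (n * real d * C)"
    using n C by (intro divide_right_mono) (simp_all add: mult.assoc)
  then have "n powr ((4 - 3 * \<alpha>) / 2) / (real d * C) * V powr (1 - \<alpha> / 2)
      \<le> 1 / (n * real d) * E"
    using n C d by (simp add: mult_ac)
  then have "- (1 / (n * real d)) * E
      \<le> - (n powr ((4 - 3 * \<alpha>) / 2) / (real d * C) * V powr (1 - \<alpha> / 2))"
    by simp
  moreover note diffusion_graph_var_has_derivative[OF fin sol t]
  ultimately show ?thesis using that unfolding card n_def C_def V_def E_def by blast
qed

section \<open>From the dissipation inequality to the decay estimates\<close>

theorem theorem10p3:
  fixes \<Gamma> :: "('v, 'e) pre_digraph"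
    and d :: nat
    and \<alpha> :: real
    and \<rho> :: "real \<Rightarrow> real"
    and J :: "real set"
    and u :: "'v \<Rightarrow> real \<Rightarrow> real"
    and t :: real
  assumes "d \<ge> 1"
    and "complete_digraph (d + 1) \<Gamma>"
    and "0 \<le> \<alpha>" and "\<alpha> < 2"
    and "\<And>s. s > 0 \<Longrightarrow> \<rho> s \<ge> 0"
    and "antimono_on {0<..} \<rho>"
    and "\<And>s. s > 0 \<Longrightarrow> \<rho> s \<ge> s powr (- \<alpha>)"
    and "is_interval J"
    and "diffusion_solution \<Gamma> d \<rho> J u"
    and "t \<in> J"
    and "\<not> (\<lambda>v. u v t) constant_on verts \<Gamma>"
  shows "(0 < \<alpha> \<longrightarrow>
           (\<exists>D. ((\<lambda>s. graph_var \<Gamma> (\<lambda>v. u v s) powr (\<alpha> / 2)) has_real_derivative D) (at t within J) \<and>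
                D \<le> - (if \<alpha> \<le> 1
                       then \<alpha> * real (d + 1) powr ((4 - 3 * \<alpha>) / 2) / (2 * real d powr (2 - \<alpha>))
                       else \<alpha> * real (d + 1) powr ((4 - 3 * \<alpha>) / 2) / (2 * real d)))) \<and>
         (\<alpha> = 0 \<longrightarrow>
           (\<exists>D. ((\<lambda>s. ln (graph_var \<Gamma> (\<lambda>v. u v s))) has_real_derivative D) (at t within J) \<and>
                D \<le> - (real (d + 1))\<^sup>2 / (real d)\<^sup>2))"
proof -
  have fin: "finite (verts \<Gamma>)" and card: "card (verts \<Gamma>) = d + 1"
  proof -
    show card: "card (verts \<Gamma>) = d + 1" using assms(2) by (simp add: complete_digraph_def)
    \<comment> \<open>An infinite set has \<open>card\<close> 0, so a positive cardinality forces
      finiteness.\<close>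
    then show "finite (verts \<Gamma>)" by (intro card_ge_0_finite) simp
  qed
  define V where "V = (\<lambda>s. graph_var \<Gamma> (\<lambda>v. u v s))"
  define K where
    "K = real (d + 1) powr ((4 - 3 * \<alpha>) / 2) / (real d * max 1 (real d powr (1 - \<alpha>)))"
  have V: "V t > 0" unfolding V_def by (rule graph_var_pos[OF fin assms(11)])
  obtain V' where V': "(V has_real_derivative V') (at t within J)"
    and V'_le: "V' \<le> - (K * V t powr (1 - \<alpha> / 2))"
    using graph_var_dissipation[OF fin card assms(1,3) less_imp_le[OF assms(4)] assms(7,9,10)]
    unfolding V_def K_def by blast
  have "\<exists>D. ((\<lambda>s. V s powr (\<alpha> / 2)) has_real_derivative D) (at t within J) \<and>
          D \<le> - (if \<alpha> \<le> 1 then \<alpha> * real (d + 1) powr ((4 - 3 * \<alpha>) / 2) / (2 * real d powr (2 - \<alpha>))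
                 else \<alpha> * real (d + 1) powr ((4 - 3 * \<alpha>) / 2) / (2 * real d))"
  proof (intro exI conjI)
    show "((\<lambda>s. V s powr (\<alpha> / 2)) has_real_derivative \<alpha> / 2 * V t powr (\<alpha> / 2 - 1) * V')
        (at t within J)"
      by (rule DERIV_chain2[OF has_real_derivative_powr[OF V] V'])
    have "\<alpha> / 2 * V t powr (\<alpha> / 2 - 1) * V'
        \<le> \<alpha> / 2 * V t powr (\<alpha> / 2 - 1) * - (K * V t powr (1 - \<alpha> / 2))"
      using V'_le assms(3) by (intro mult_left_mono) auto
    \<comment> \<open>The exponents \<open>\<alpha> / 2 - 1\<close> and
      \<open>1 - \<alpha> / 2\<close> are opposite, and \<open>V t > 0\<close> makes the product of
      the two powers 1.\<close>
    also have "\<dots> = - (\<alpha> / 2 * K)"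
      using V by (simp flip: powr_add)
    also have "\<alpha> / 2 * K = (if \<alpha> \<le> 1
        then \<alpha> * real (d + 1) powr ((4 - 3 * \<alpha>) / 2) / (2 * real d powr (2 - \<alpha>))
        else \<alpha> * real (d + 1) powr ((4 - 3 * \<alpha>) / 2) / (2 * real d))"
    \<comment> \<open>As \<open>d \<ge> 1\<close>, the sign of \<open>1 - \<alpha>\<close> decides
      the maximum in \<open>K\<close>: it is \<open>real d powr (1 - \<alpha>)\<close> for
      \<open>\<alpha> \<le> 1\<close> and 1 otherwise.\<close>
    proof (cases "\<alpha> \<le> 1")
      case True
      have "max 1 (real d powr (1 - \<alpha>)) = real d powr (1 - \<alpha>)"
        using True assms(1) by (simp add: max_def ge_one_powr_ge_zero)
      moreover have "real d * real d powr (1 - \<alpha>) = real d powr (2 - \<alpha>)"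
        using assms(1) by (simp add: powr_mult_base)
      ultimately show ?thesis using True by (simp add: K_def)
    next
      case False
      have "real d powr (1 - \<alpha>) \<le> real d powr 0"
        using False assms(1) by (intro powr_mono) auto
      then show ?thesis using False assms(1) by (simp add: K_def)
    qed
    finally show "\<alpha> / 2 * V t powr (\<alpha> / 2 - 1) * V' \<le> - (if \<alpha> \<le> 1
        then \<alpha> * real (d + 1) powr ((4 - 3 * \<alpha>) / 2) / (2 * real d powr (2 - \<alpha>))
        else \<alpha> * real (d + 1) powr ((4 - 3 * \<alpha>) / 2) / (2 * real d))" .
  qed
  moreover have "\<exists>D. ((\<lambda>s. ln (V s)) has_real_derivative D) (at t within J) \<and>
      D \<le> - (real (d + 1))\<^sup>2 / (real d)\<^sup>2" if \<alpha>: "\<alpha> = 0"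
  proof (intro exI conjI)
    show "((\<lambda>s. ln (V s)) has_real_derivative 1 / V t * V') (at t within J)"
      by (rule DERIV_chain2[OF DERIV_ln_divide[OF V] V'])
    \<comment> \<open>At \<open>\<alpha> = 0\<close> the exponent of \<open>d + 1\<close> is 2, the
      maximum is \<open>d\<close>, and the dissipation inequality is linear in \<open>V t\<close>,
      so dividing by \<open>V t\<close> gives the bound.\<close>
    have "K = (real (d + 1))\<^sup>2 / (real d)\<^sup>2"
      using assms(1) by (simp add: K_def \<alpha> power2_eq_square)
    then show "1 / V t * V' \<le> - (real (d + 1))\<^sup>2 / (real d)\<^sup>2"
      using V'_le V by (simp add: \<alpha> field_simps)
  qed
  ultimately show ?thesis unfolding V_def by blast
qed

end
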